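(* Let $\mathbb F$ be a differential field with an algebraically closed field of constants $\mathbb K$. If $M \in \mathbb F^{n,n}$ is of Type 1, then $M$ is $\mathbb K$-triangularizable.
   Context: A differential field $\mathbb F$ is an (algebraic) field together with an additional operation ${}'$ (the derivative) satisfying $(a+b)'=a'+b'$ and $(ab)'=ab'+a'b$ for all $a,b\in\mathbb F$. An element $a\in\mathbb F$ is a constant if $a'=0$; the constants form a subfield $\mathbb K$ of $\mathbb F$, called the field of constants. $\mathbb F^{n,n}$ denotes the $n\times n$ matrices over $\mathbb F$. For a subfield $\mathbb H$ of $\mathbb F$, a matrix $M\in\mathbb F^{n,n}$ is $\mathbb H$-triangularizable if there exists a nonsingular $T\in\mathbb H^{n,n}$ such that $T^{-1}MT$ is upper triangular. A matrix $M\in\mathbb F^{n,n}$ is of Type 1 if $M=\sum_{j=1}^{k} f_j C_j$ for some $f_j\in\mathbb F$ and some pairwise commuting $C_j\in\mathbb K^{n,n}$, $j=1,\ldots,k$. *)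

theory Defs
  imports "HOL-Computational_Algebra.Polynomial" "Jordan_Normal_Form.Matrix"
begin

locale differential_field =
  fixes D :: "'a::field \<Rightarrow> 'a"
  assumes D_add: "D (a + b) = D a + D b"
    and D_mult: "D (a * b) = D a * b + a * D b"

definition constants :: "('a::field \<Rightarrow> 'a) \<Rightarrow> 'a set" where
  "constants D = {a. D a = 0}"

text \<open>Subfields are subsets of the ambient field type, and matrices over a subfield are
  matrices over the ambient type all of whose entries lie in that subset.\<close>

definition is_subfield :: "'a::field set \<Rightarrow> bool" where
  "is_subfield H \<longleftrightarrow> 0 \<in> H \<and> 1 \<in> H
     \<and> (\<forall>a\<in>H. \<forall>b\<in>H. a + b \<in> H \<and> a * b \<in> H)
     \<and> (\<forall>a\<in>H. - a \<in> H \<and> inverse a \<in> H)"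

lemma (in differential_field) is_subfield_constants: "is_subfield (constants D)"
proof -
  have D0: "D 0 = 0" by (metis D_add add_0_right add_cancel_right_right)
  have D1: "D 1 = 0" by (metis D_mult mult_1_left mult_1_right add_cancel_right_right)
  have neg: "D (- a) = 0" if "D a = 0" for a
    using D_add[of a "- a"] D0 that by simp
  have inv: "D (inverse a) = 0" if "D a = 0" for a
    using D_mult[of a "inverse a"] D0 D1 that by (cases "a = 0") auto
  show ?thesis
    using D0 D1 neg inv by (auto simp: is_subfield_def constants_def D_add D_mult)
qed

text \<open>The relativisation to a subset of the condition defining the class
  \<^class>\<open>alg_closed_field\<close>.\<close>

definition alg_closed_subfield :: "'a::field set \<Rightarrow> bool" where
  "alg_closed_subfield K \<longleftrightarrow> is_subfield K \<and>
     (\<forall>p. (\<forall>i. coeff p i \<in> K) \<and> degree p > 0 \<longrightarrow> (\<exists>x\<in>K. poly p x = 0))"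

definition mats_over :: "'a set \<Rightarrow> nat \<Rightarrow> 'a mat set" where
  "mats_over H n = {A \<in> carrier_mat n n. elements_mat A \<subseteq> H}"

text \<open>Below, \<open>S\<close> is the inverse of \<open>T\<close>; if \<open>H\<close> is a subfield, its entries
  are in \<open>H\<close> automatically.\<close>

definition triangularizable :: "'a::field set \<Rightarrow> nat \<Rightarrow> 'a mat \<Rightarrow> bool" where
  "triangularizable H n M \<longleftrightarrow>
     (\<exists>T \<in> mats_over H n. \<exists>S \<in> carrier_mat n n.
        inverts_mat T S \<and> inverts_mat S T \<and> upper_triangular (S * M * T))"

text \<open>The type \<^typ>\<open>'a mat\<close> has no zero element independent of the dimension, so the matrix sum
  \<open>M = f\<^sub>1 C\<^sub>1 + \<dots> + f\<^sub>k C\<^sub>k\<close> is formed entrywise.\<close>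

definition type_1 :: "('a::field \<Rightarrow> 'a) \<Rightarrow> nat \<Rightarrow> 'a mat \<Rightarrow> bool" where
  "type_1 D n M \<longleftrightarrow>
     (\<exists>k (f :: nat \<Rightarrow> 'a) C.
        (\<forall>j\<in>{1..k}. C j \<in> mats_over (constants D) n) \<and>
        (\<forall>i\<in>{1..k}. \<forall>j\<in>{1..k}. C i * C j = C j * C i) \<and>
        M = mat n n (\<lambda>(a, b). \<Sum>j = 1..k. (f j \<cdot>\<^sub>m C j) $$ (a, b)))"

end

(* A single T over K triangularizes all the C_j at once, hence every F-linear combination of them.
   T is built by induction on n from a common eigenvector over K. The field of constants is a subset
   and not a type, so the library results on eigenvalues and bases do not apply to it: all vectors
   and matrices have to be tracked as having entries in K. *)

theory Submission
  imports Defs "Jordan_Normal_Form.Determinant" "HOL-Combinatorics.Transposition"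
begin

section \<open>Arithmetic and linear dependence over a subfield\<close>

lemma mats_over_iff:
  "A \<in> mats_over H n \<longleftrightarrow> A \<in> carrier_mat n n \<and> (\<forall>i<n. \<forall>j<n. A $$ (i, j) \<in> H)"
  unfolding mats_over_def by (fastforce dest: elements_matD)

context
  fixes K :: "'a::field set"
  assumes K: "is_subfield K"
begin

lemma subfield_closed:
  shows "0 \<in> K" "1 \<in> K"
    and "a \<in> K \<Longrightarrow> b \<in> K \<Longrightarrow> a + b \<in> K"
    and "a \<in> K \<Longrightarrow> b \<in> K \<Longrightarrow> a * b \<in> K"
    and "a \<in> K \<Longrightarrow> - a \<in> K"
    and "a \<in> K \<Longrightarrow> inverse a \<in> K"
  using K by (auto simp: is_subfield_def)

lemma subfield_diff: "a \<in> K \<Longrightarrow> b \<in> K \<Longrightarrow> a - b \<in> K"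
  using subfield_closed(3)[of a "- b"] subfield_closed(5) by simp

lemma subfield_divide: "a \<in> K \<Longrightarrow> b \<in> K \<Longrightarrow> a / b \<in> K"
  by (simp add: divide_inverse subfield_closed)

lemma subfield_sum: "(\<And>i. i \<in> I \<Longrightarrow> f i \<in> K) \<Longrightarrow> sum f I \<in> K"
  by (induction I rule: infinite_finite_induct) (auto simp: subfield_closed)

lemmas subfield_intros = subfield_closed subfield_diff subfield_divide subfield_sum

text \<open>Gaussian elimination: \<open>J\<close> indexes homogeneous equations, \<open>I\<close>
  the more numerous unknowns. If equation \<open>j\<close> has a nonzero coefficient at some unknown
  \<open>p\<close>, it is solved for that unknown and both are dropped; otherwise \<open>j\<close>
  alone is dropped. Only field operations occur, so the solution stays in \<open>K\<close>. Index
  sets spare any renumbering.\<close>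

lemma subfield_linear_dependence:
  fixes f :: "'i \<Rightarrow> 'j \<Rightarrow> 'a"
  assumes "finite J" "finite I" "card J < card I"
    and "\<And>i j. i \<in> I \<Longrightarrow> j \<in> J \<Longrightarrow> f i j \<in> K"
  shows "\<exists>c. (\<forall>i\<in>I. c i \<in> K) \<and> (\<exists>i\<in>I. c i \<noteq> 0) \<and> (\<forall>j\<in>J. (\<Sum>i\<in>I. c i * f i j) = 0)"
  using assms
proof (induction J arbitrary: I f rule: finite_induct)
  case empty
  then have "I \<noteq> {}" by auto
  then show ?case by (intro exI[of _ "\<lambda>_. 1"]) (auto simp: subfield_closed)
next
  case (insert j J)
  show ?case
  proof (cases "\<forall>i\<in>I. f i j = 0")
    case True
    have "card J < card I" using insert by simp
    from insert.IH[OF insert.prems(1) this insert.prems(3)] True show ?thesis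
      by fastforce
  next
    case False
    then obtain p where p: "p \<in> I" "f p j \<noteq> 0" by auto
    define I' where "I' = I - {p}"
    \<comment> \<open>Coefficients of equation \<open>l\<close> after the unknown \<open>p\<close>
      has been eliminated by means of equation \<open>j\<close>.\<close>
    define g where "g i l = f i l - f i j / f p j * f p l" for i l
    have fin': "finite I'" using insert.prems unfolding I'_def by simp
    have I: "I = insert p I'" "p \<notin> I'" using p unfolding I'_def by auto
    have "card J < card I'"
      using insert.prems(2) insert.hyps I fin' by simp
    moreover have "g i l \<in> K" if "i \<in> I'" "l \<in> J" for i l
      using that insert.prems(3) p(1) I unfolding g_def by (auto intro!: subfield_intros)
    ultimately obtain c where c: "\<forall>i\<in>I'. c i \<in> K" "\<exists>i\<in>I'. c i \<noteq> 0"
        "\<forall>l\<in>J. (\<Sum>i\<in>I'. c i * g i l) = 0"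
      using insert.IH[OF fin', of g] by blast
    define s where "s = (\<Sum>i\<in>I'. c i * f i j)"
    \<comment> \<open>The value at \<open>p\<close> is the one that equation \<open>j\<close>
      forces; a nonzero entry of \<open>c\<close> persists because \<open>p\<close> lies outside
      \<open>I'\<close>.\<close>
    define c' where "c' = c(p := - s / f p j)"
    have sum_c': "(\<Sum>i\<in>I. c' i * h i) = (\<Sum>i\<in>I'. c i * h i) - s / f p j * h p" for h
    proof -
      have "(\<Sum>i\<in>I'. c' i * h i) = (\<Sum>i\<in>I'. c i * h i)"
        using I(2) by (intro sum.cong) (auto simp: c'_def)
      then show ?thesis using I fin' by (simp add: c'_def)
    qed
    have "(\<Sum>i\<in>I. c' i * f i l) = 0" if l: "l \<in> insert j J" for l
    proof (cases "l = j")
      case True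
      then show ?thesis unfolding sum_c' using p by (simp add: s_def)
    next
      case False
      then have "0 = (\<Sum>i\<in>I'. c i * g i l)" using l c(3) by simp
      also have "\<dots> = (\<Sum>i\<in>I'. c i * f i l - c i * f i j * (f p l / f p j))"
        by (simp add: g_def right_diff_distrib mult.assoc)
      also have "\<dots> = (\<Sum>i\<in>I'. c i * f i l) - s * (f p l / f p j)"
        by (simp only: sum_subtractf sum_distrib_right[symmetric] s_def)
      finally show ?thesis unfolding sum_c' by simp
    qed
    moreover have "s \<in> K" unfolding s_def
      using c(1) insert.prems(3) I by (auto intro!: subfield_intros)
    then have "\<forall>i\<in>I. c' i \<in> K"
      using c(1) insert.prems(3) p(1) I by (auto simp: c'_def intro!: subfield_intros)
    moreover have "\<exists>i\<in>I. c' i \<noteq> 0"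
      using c(2) I by (auto simp: c'_def)
    ultimately show ?thesis by blast
  qed
qed

text \<open>Comparing coefficients gives \<open>coeff q i\<close> from
  \<open>coeff q (Suc i)\<close>, so membership descends from the zero coefficients above the
  degree, where the truncated difference \<open>Suc (degree q) - i\<close> is 0. This keeps the
  quotient over \<open>K\<close> when a root is split off.\<close>

lemma subfield_coeff_linear_factor:
  assumes "\<And>i. coeff ([:- x, 1:] * q) i \<in> K" "x \<in> K"
  shows "coeff q i \<in> K"
proof (induction "Suc (degree q) - i" arbitrary: i)
  case 0
  then show ?case by (simp add: coeff_eq_0 subfield_closed)
next
  case (Suc d)
  then have "coeff q (Suc i) \<in> K" by simp
  moreover have "coeff q i = coeff ([:- x, 1:] * q) (Suc i) + x * coeff q (Suc i)"
    by simp
  ultimately show ?case using assms by (metis subfield_closed(3,4))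
qed

section \<open>Eigenvectors with entries in the subfield\<close>

definition vecs_over :: "nat \<Rightarrow> 'a vec set" where
  "vecs_over n = {v \<in> carrier_vec n. \<forall>i<n. v $ i \<in> K}"

lemma mult_mat_vec_over:
  assumes "A \<in> mats_over K n" "v \<in> vecs_over n"
  shows "A *\<^sub>v v \<in> vecs_over n"
  using assms
  by (auto simp: mats_over_iff vecs_over_def scalar_prod_def intro!: subfield_intros)

lemma mult_mat_over:
  assumes "A \<in> mats_over K n" "B \<in> mats_over K n"
  shows "A * B \<in> mats_over K n"
  using assms by (auto simp: mats_over_iff scalar_prod_def intro!: subfield_intros)

text \<open>Every vector is annihilated by a nonzero polynomial in \<open>A\<close>. Splitting off a linear factor
  \<open>X - x\<close> either reveals an eigenvector or replaces \<open>w\<close> by \<open>(A - x) w\<close>, which is annihilated by a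
  polynomial of smaller degree.\<close>

lemma eigenvector_of_annihilator:
  assumes alg: "alg_closed_subfield K"
    and A: "A \<in> carrier_mat n n"
    and W: "W \<subseteq> carrier_vec n" "\<And>w x. w \<in> W \<Longrightarrow> x \<in> K \<Longrightarrow> A *\<^sub>v w - x \<cdot>\<^sub>v w \<in> W"
    and "w \<in> W" "w \<noteq> 0\<^sub>v n" "p \<noteq> 0" "\<And>i. coeff p i \<in> K"
    and "\<And>j. j < n \<Longrightarrow> (\<Sum>i\<le>degree p. coeff p i * (((*\<^sub>v) A ^^ i) w) $ j) = 0"
  shows "\<exists>v\<in>W. \<exists>x\<in>K. v \<noteq> 0\<^sub>v n \<and> A *\<^sub>v v = x \<cdot>\<^sub>v v"
  using assms(5-)
proof (induction "degree p" arbitrary: p w)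
  case 0
  \<comment> \<open>A nonzero constant annihilator would force \<open>w\<close> to be zero, which is
    excluded.\<close>
  have "coeff p 0 \<noteq> 0" using 0 leading_coeff_0_iff[of p] by simp
  then have "w $ j = 0" if "j < n" for j using 0(6)[OF that] 0(1)[symmetric] by simp
  then have "w = 0\<^sub>v n" using 0 W by (intro eq_vecI) auto
  then show ?case using 0 by blast
next
  case (Suc d)
  from alg Suc.hyps(2) Suc.prems(4) obtain x where x: "x \<in> K" "poly p x = 0"
    unfolding alg_closed_subfield_def by (metis zero_less_Suc)
  then obtain q where q: "p = [:- x, 1:] * q" by (metis poly_eq_0_iff_dvd dvd_def)
  have q0: "q \<noteq> 0" using q Suc.prems by auto
  have "degree p = Suc (degree q)" unfolding q using q0 by (subst degree_mult_eq) auto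
  then have deg: "degree q = d" using Suc.hyps by simp
  have qK: "coeff q i \<in> K" for i
    using subfield_coeff_linear_factor[of x q] x Suc.prems(4) q by blast
  define s where "s i = ((*\<^sub>v) A ^^ i) w" for i
  have s: "s i \<in> carrier_vec n" for i
    using Suc.prems(1) W A by (induction i) (auto simp: s_def)
  define w' where "w' = A *\<^sub>v w - x \<cdot>\<^sub>v w"
  have w'W: "w' \<in> W" unfolding w'_def using W Suc.prems x by blast
  \<comment> \<open>Powers of \<open>A\<close> commute with \<open>A - x\<close>, so the iterates of
    \<open>w'\<close> come from those of \<open>w\<close>.\<close>
  have s': "((*\<^sub>v) A ^^ i) w' = s (Suc i) - x \<cdot>\<^sub>v s i" for i
  proof (induction i)
    case 0
    then show ?case by (simp add: w'_def s_def)
  next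
    case (Suc i)
    have "((*\<^sub>v) A ^^ Suc i) w' = A *\<^sub>v (s (Suc i) - x \<cdot>\<^sub>v s i)" using Suc by simp
    also have "\<dots> = A *\<^sub>v s (Suc i) - x \<cdot>\<^sub>v (A *\<^sub>v s i)"
      using s[of i] s[of "Suc i"] A by (simp add: mult_minus_distrib_mat_vec mult_mat_vec)
    finally show ?case by (simp add: s_def)
  qed
  show ?case
  proof (cases "w' = 0\<^sub>v n")
    case True
    have "A *\<^sub>v w = x \<cdot>\<^sub>v w"
    proof (rule eq_vecI)
      fix i assume "i < dim_vec (x \<cdot>\<^sub>v w)"
      then have i: "i < n" using Suc.prems(1) W by auto
      have "w' $ i = 0" using True i by simp
      then show "(A *\<^sub>v w) $ i = (x \<cdot>\<^sub>v w) $ i"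
        using i Suc.prems(1) W A unfolding w'_def by auto
    qed (use A W Suc.prems(1) in auto)
    then show ?thesis using Suc.prems x by blast
  next
    case False
    have "(\<Sum>i\<le>degree q. coeff q i * (((*\<^sub>v) A ^^ i) w') $ j) = 0" if j: "j < n" for j
    proof -
      \<comment> \<open>The index \<open>Suc d\<close> exceeds the degree of \<open>q\<close>; its
        zero term lets both parts of the product be summed over one range.\<close>
      have lower: "(\<Sum>i\<le>Suc d. coeff q i * s i $ j) = (\<Sum>i\<le>d. coeff q i * s i $ j)"
        by (simp add: coeff_eq_0 deg)
      have "0 = (\<Sum>i\<le>Suc d. coeff p i * s i $ j)"
        using Suc.prems(5)[OF j] Suc.hyps(2)[symmetric] by (simp only: s_def)
      \<comment> \<open>The product is read as X q - x q, where \<open>pCons 0 q\<close> stands for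
        X q.\<close>
      also have "\<dots> = (\<Sum>i\<le>Suc d. coeff (pCons 0 q) i * s i $ j - x * (coeff q i * s i $ j))"
        unfolding q by (intro sum.cong) (auto simp: algebra_simps)
      also have "\<dots> = (\<Sum>i\<le>Suc d. coeff (pCons 0 q) i * s i $ j)
          - x * (\<Sum>i\<le>d. coeff q i * s i $ j)"
        by (simp only: sum_subtractf sum_distrib_left[symmetric] lower)
      \<comment> \<open>The constant term of X q is zero; shifting the index turns multiplication by
        X into one more application of \<open>A\<close>.\<close>
      also have "(\<Sum>i\<le>Suc d. coeff (pCons 0 q) i * s i $ j) = (\<Sum>i\<le>d. coeff q i * s (Suc i) $ j)"
        by (subst sum.atMost_Suc_shift) simp
      also have "\<dots> - x * (\<Sum>i\<le>d. coeff q i * s i $ j)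
          = (\<Sum>i\<le>d. coeff q i * (s (Suc i) - x \<cdot>\<^sub>v s i) $ j)"
        unfolding sum_distrib_left sum_subtractf[symmetric]
        using carrier_vecD[OF s] j by (intro sum.cong) (auto simp: algebra_simps)
      finally show ?thesis by (simp add: s' deg)
    qed
    then show ?thesis using Suc.hyps(1)[OF deg[symmetric] w'W False q0 qK] by blast
  qed
qed

text \<open>The \<open>n + 1\<close> iterates from \<open>w\<close> to A^n w have \<open>n\<close>
  coordinates each, so they are linearly dependent over \<open>K\<close>, and a dependence is an
  annihilating polynomial. The set \<open>W\<close> allows the eigenvector to be sought inside an
  eigenspace of other matrices.\<close>

lemma eigenvector_over:
  assumes alg: "alg_closed_subfield K"
    and A: "A \<in> mats_over K n"
    and W: "W \<subseteq> vecs_over n" "\<And>w x. w \<in> W \<Longrightarrow> x \<in> K \<Longrightarrow> A *\<^sub>v w - x \<cdot>\<^sub>v w \<in> W"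
    and w: "w \<in> W" "w \<noteq> 0\<^sub>v n"
  shows "\<exists>v\<in>W. \<exists>x\<in>K. v \<noteq> 0\<^sub>v n \<and> A *\<^sub>v v = x \<cdot>\<^sub>v v"
proof -
  define s where "s i = ((*\<^sub>v) A ^^ i) w" for i
  have s: "s i \<in> vecs_over n" for i
    using w W by (induction i) (auto simp: s_def intro!: mult_mat_vec_over[OF A])
  have "\<exists>c. (\<forall>i\<in>{..n}. c i \<in> K) \<and> (\<exists>i\<in>{..n}. c i \<noteq> 0)
      \<and> (\<forall>j\<in>{..<n}. (\<Sum>i\<in>{..n}. c i * s i $ j) = 0)"
    using s by (intro subfield_linear_dependence) (auto simp: vecs_over_def)
  then obtain c where c: "\<forall>i\<le>n. c i \<in> K" "\<exists>i\<le>n. c i \<noteq> 0"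
      "\<forall>j<n. (\<Sum>i\<le>n. c i * s i $ j) = 0"
    by auto
  define p where "p = Poly (map c [0..<Suc n])"
  have coeff_p: "coeff p i = (if i \<le> n then c i else 0)" for i
    by (simp add: p_def nth_default_def nth_append del: upt_Suc)
  have "p \<noteq> 0" using c(2) coeff_p by (metis coeff_0)
  moreover have "coeff p i \<in> K" for i using c(1) by (simp add: coeff_p subfield_closed)
  moreover have "(\<Sum>i\<le>degree p. coeff p i * s i $ j) = 0" if j: "j < n" for j
  proof -
    \<comment> \<open>Since \<open>c n\<close> may vanish, the degree may be less than
      \<open>n\<close>; the surplus terms are zero.\<close>
    have "degree p \<le> n" by (rule degree_le) (simp add: coeff_p)
    then have "(\<Sum>i\<le>degree p. coeff p i * s i $ j) = (\<Sum>i\<le>n. coeff p i * s i $ j)"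
      by (intro sum.mono_neutral_left) (auto simp: coeff_eq_0)
    also have "\<dots> = (\<Sum>i\<le>n. c i * s i $ j)" by (simp add: coeff_p)
    finally show ?thesis using c(3) j by simp
  qed
  ultimately show ?thesis
    using A W w
    by (intro eigenvector_of_annihilator[OF alg, where p = p and w = w])
      (auto simp: mats_over_def vecs_over_def s_def)
qed

section \<open>Common eigenvectors and their completion to invertible matrices\<close>

text \<open>Commuting matrices preserve each other's eigenspaces: the eigenspace of \<open>A\<close>
  inside \<open>W\<close> inherits the stability under the remaining matrices and contains a nonzero
  vector. Hence \<open>W\<close> is kept arbitrary in the induction on \<open>Cs\<close>.\<close>

lemma common_eigenvector:
  assumes alg: "alg_closed_subfield K"
    and "finite Cs" "Cs \<subseteq> mats_over K n"
    and "\<And>A B. A \<in> Cs \<Longrightarrow> B \<in> Cs \<Longrightarrow> A * B = B * A"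
    and "W \<subseteq> vecs_over n" "w \<in> W" "w \<noteq> 0\<^sub>v n"
    and "\<And>A w x. A \<in> Cs \<Longrightarrow> w \<in> W \<Longrightarrow> x \<in> K \<Longrightarrow> A *\<^sub>v w - x \<cdot>\<^sub>v w \<in> W"
  shows "\<exists>v\<in>W. v \<noteq> 0\<^sub>v n \<and> (\<forall>A\<in>Cs. \<exists>x\<in>K. A *\<^sub>v v = x \<cdot>\<^sub>v v)"
  using assms(2-)
proof (induction Cs arbitrary: W w rule: finite_induct)
  case empty
  then show ?case by auto
next
  case (insert A Cs)
  have A: "A \<in> mats_over K n" using insert.prems(1) by simp
  obtain v x where v: "v \<in> W" "x \<in> K" "v \<noteq> 0\<^sub>v n" "A *\<^sub>v v = x \<cdot>\<^sub>v v"
    using eigenvector_over[OF alg A insert.prems(3) _ insert.prems(4,5)] insert.prems(6) by blast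
  define W' where "W' = {w \<in> W. A *\<^sub>v w = x \<cdot>\<^sub>v w}"
  have "B *\<^sub>v u - y \<cdot>\<^sub>v u \<in> W'" if B: "B \<in> Cs" and u: "u \<in> W'" and y: "y \<in> K" for B u y
  proof -
    have carr: "A \<in> carrier_mat n n" "B \<in> carrier_mat n n" "u \<in> carrier_vec n"
      using A insert.prems(1,3) B u by (auto simp: mats_over_def vecs_over_def W'_def)
    have Au: "A *\<^sub>v u = x \<cdot>\<^sub>v u" using u by (simp add: W'_def)
    \<comment> \<open>Commutation puts \<open>B u\<close> into the eigenspace of \<open>A\<close>
      for \<open>x\<close>; subtracting a multiple of \<open>u\<close> does not leave it.\<close>
    have "A *\<^sub>v (B *\<^sub>v u) = (B * A) *\<^sub>v u"
      using carr B insert.prems(2)[of A B] by (simp flip: assoc_mult_mat_vec)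
    also have "\<dots> = x \<cdot>\<^sub>v (B *\<^sub>v u)" using carr Au by (simp add: mult_mat_vec)
    finally have "A *\<^sub>v (B *\<^sub>v u - y \<cdot>\<^sub>v u) = x \<cdot>\<^sub>v (B *\<^sub>v u) - y \<cdot>\<^sub>v (x \<cdot>\<^sub>v u)"
      using carr Au by (simp add: mult_minus_distrib_mat_vec mult_mat_vec)
    also have "\<dots> = x \<cdot>\<^sub>v (B *\<^sub>v u - y \<cdot>\<^sub>v u)"
      using carr by (intro eq_vecI) (auto simp: algebra_simps)
    finally show ?thesis using insert.prems(6)[of B u y] B u y by (auto simp: W'_def)
  qed
  then have "\<exists>v\<in>W'. v \<noteq> 0\<^sub>v n \<and> (\<forall>A\<in>Cs. \<exists>x\<in>K. A *\<^sub>v v = x \<cdot>\<^sub>v v)"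
    using insert.prems v by (intro insert.IH[of W' v]) (auto simp: W'_def)
  then show ?case using v(2) unfolding W'_def by blast
qed

text \<open>Replace a unit vector \<open>e\<^sub>k\<close> with \<open>v\<^sub>k \<noteq> 0\<close> by \<open>v\<close>, and swap the columns \<open>0\<close> and \<open>k\<close>.\<close>

lemma extend_to_invertible:
  assumes v: "v \<in> vecs_over n" "v \<noteq> 0\<^sub>v n"
  shows "\<exists>T \<in> mats_over K n. \<exists>S \<in> mats_over K n. T * S = 1\<^sub>m n \<and> S * T = 1\<^sub>m n \<and> col T 0 = v"
proof -
  obtain k where k: "k < n" "v $ k \<noteq> 0"
    using v unfolding vecs_over_def
    by (metis (mono_tags, lifting) carrier_vecD eq_vecI index_zero_vec mem_Collect_eq)
  define \<tau> where "\<tau> = transpose 0 k"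
  have \<tau>_lt: "\<tau> i < n" if "i < n" for i using that k by (auto simp: \<tau>_def transpose_def)
  have \<tau>_eq: "\<tau> i = k \<longleftrightarrow> i = 0" "\<tau> i = \<tau> j \<longleftrightarrow> i = j" for i j
    by (auto simp: \<tau>_def transpose_def)
  define T where "T = mat n n (\<lambda>(i, j). if j = 0 then v $ i else if i = \<tau> j then 1 else 0)"
  \<comment> \<open>\<open>S\<close> takes coordinates in the basis of columns of \<open>T\<close>:
    along \<open>v\<close> a vector \<open>u\<close> has the coordinate
    \<open>u $ k / v $ k\<close>, and along the unit vector with index \<open>\<tau> i\<close> it
    has \<open>u $ \<tau> i\<close> less the contribution of \<open>v\<close>.\<close>
  define S where "S = mat n n (\<lambda>(i, j). if i = 0 then (if j = k then 1 / v $ k else 0)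
    else (if j = \<tau> i then 1 else 0) - (if j = k then v $ \<tau> i / v $ k else 0))"
  have T: "T \<in> mats_over K n" and S: "S \<in> mats_over K n"
    using v k \<tau>_lt
    by (auto simp: mats_over_iff T_def S_def vecs_over_def intro!: subfield_intros)
  have "S * T = 1\<^sub>m n"
  proof (rule eq_matI)
    fix i j assume "i < dim_row (1\<^sub>m n)" "j < dim_col (1\<^sub>m n)"
    then have ij: "i < n" "j < n" by auto
    define t where "t l = T $$ (l, j)" for l
    have "(S * T) $$ (i, j) = (\<Sum>l<n. S $$ (i, l) * t l)"
      using ij by (simp add: S_def T_def t_def scalar_prod_def lessThan_atLeast0)
    also have "\<dots> = (if i = 0 then t k / v $ k else t (\<tau> i) - v $ \<tau> i / v $ k * t k)"
    proof (cases "i = 0")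
      case True
      have "(\<Sum>l<n. S $$ (i, l) * t l) = (\<Sum>l<n. if l = k then t k / v $ k else 0)"
        using ij True by (intro sum.cong) (auto simp: S_def)
      then show ?thesis using True k by simp
    next
      case False
      have "(\<Sum>l<n. S $$ (i, l) * t l)
          = (\<Sum>l<n. (if l = \<tau> i then t (\<tau> i) else 0) - (if l = k then v $ \<tau> i / v $ k * t k else 0))"
        using ij False by (intro sum.cong) (auto simp: S_def algebra_simps)
      then show ?thesis using False k \<tau>_lt[OF ij(1)] by (simp add: sum_subtractf)
    qed
    \<comment> \<open>For \<open>j = 0\<close> the column \<open>t\<close> is \<open>v\<close> and
      the two terms of a row \<open>i > 0\<close> cancel; for \<open>j > 0\<close> it is a unit
      vector with \<open>t k = 0\<close>.\<close>
    also have "\<dots> = 1\<^sub>m n $$ (i, j)"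
      using ij k \<tau>_lt \<tau>_eq(1)[of j] \<tau>_eq(2)[of i j] by (auto simp: t_def T_def)
    finally show "(S * T) $$ (i, j) = 1\<^sub>m n $$ (i, j)" .
  qed (auto simp: S_def T_def)
  moreover have "T * S = 1\<^sub>m n"
    using mat_mult_left_right_inverse[OF _ _ \<open>S * T = 1\<^sub>m n\<close>] S T by (auto simp: mats_over_def)
  moreover have "col T 0 = v"
    using v k by (intro eq_vecI) (auto simp: T_def vecs_over_def)
  ultimately show ?thesis using S T by blast
qed

section \<open>Simultaneous triangularization by block matrices\<close>

text \<open>In a basis that starts with a common eigenvector all conjugates are block triangular
  with a 1 x 1 corner. Their lower right blocks commute again, so the induction hypothesis applies
  to them. The inverse \<open>S\<close> is also required over \<open>K\<close>, since the blocks
  passed to the induction must have entries there.\<close>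

lemma simultaneous_triangularization:
  assumes alg: "alg_closed_subfield K"
    and "finite Cs" "Cs \<subseteq> mats_over K n"
    and "\<And>A B. A \<in> Cs \<Longrightarrow> B \<in> Cs \<Longrightarrow> A * B = B * A"
  shows "\<exists>T \<in> mats_over K n. \<exists>S \<in> mats_over K n. T * S = 1\<^sub>m n \<and> S * T = 1\<^sub>m n
    \<and> (\<forall>C\<in>Cs. upper_triangular (S * C * T))"
  using assms(2-)
proof (induction n arbitrary: Cs)
  case 0
  have "1\<^sub>m 0 \<in> mats_over K 0" by (auto simp: mats_over_iff)
  moreover have "upper_triangular (1\<^sub>m 0 * C * 1\<^sub>m 0)" if "C \<in> Cs" for C
    by (auto simp: upper_triangular_def)
  ultimately show ?case by (metis left_mult_one_mat one_carrier_mat)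
next
  case (Suc n)
  let ?N = "Suc n"
  \<comment> \<open>All vectors over \<open>K\<close> form the stable set; the unit vector witnesses
    that it is nonzero.\<close>
  have "unit_vec ?N 0 \<in> vecs_over ?N"
    by (auto simp: vecs_over_def subfield_closed)
  moreover have "unit_vec ?N 0 \<noteq> (0\<^sub>v ?N :: 'a vec)"
    by (metis index_unit_vec(1) index_zero_vec(1) zero_less_Suc zero_neq_one)
  moreover have "A *\<^sub>v w - x \<cdot>\<^sub>v w \<in> vecs_over ?N"
    if "A \<in> Cs" "w \<in> vecs_over ?N" "x \<in> K" for A w x
    using that mult_mat_vec_over[OF subsetD[OF Suc.prems(2)]]
    by (auto simp: vecs_over_def simp del: index_mult_mat_vec intro!: subfield_intros)
  ultimately obtain v where v: "v \<in> vecs_over ?N" "v \<noteq> 0\<^sub>v ?N"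
      "\<forall>A\<in>Cs. \<exists>x\<in>K. A *\<^sub>v v = x \<cdot>\<^sub>v v"
    using common_eigenvector[OF alg Suc.prems, of "vecs_over ?N" "unit_vec ?N 0"] by blast
  obtain T1 S1 where T1: "T1 \<in> mats_over K ?N" and S1: "S1 \<in> mats_over K ?N"
    and TS: "T1 * S1 = 1\<^sub>m ?N" "S1 * T1 = 1\<^sub>m ?N" and col: "col T1 0 = v"
    using extend_to_invertible[OF v(1,2)] by blast
  have c1: "T1 \<in> carrier_mat ?N ?N" "S1 \<in> carrier_mat ?N ?N"
    using T1 S1 by (auto simp: mats_over_def)
  have carr: "C \<in> carrier_mat ?N ?N" if "C \<in> Cs" for C
    using that Suc.prems(2) by (auto simp: mats_over_def)
  define conj where "conj C = S1 * C * T1" for C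
  have conj_over: "conj C \<in> mats_over K ?N" if "C \<in> Cs" for C
    using that Suc.prems(2) S1 T1 unfolding conj_def by (auto intro!: mult_mat_over)
  have conj_carr: "conj C \<in> carrier_mat ?N ?N" if "C \<in> Cs" for C
    using conj_over[OF that] by (simp add: mats_over_def)
  have conj_mult: "conj A * conj B = S1 * (A * B) * T1" if "A \<in> Cs" "B \<in> Cs" for A B
  proof -
    note c = carr[OF that(1)] carr[OF that(2)] c1
    have "conj A * conj B = S1 * A * (T1 * S1) * B * T1"
      unfolding conj_def using c by (simp add: assoc_mult_mat[of _ ?N ?N _ ?N _ ?N])
    then show ?thesis using c by (simp add: TS assoc_mult_mat[of _ ?N ?N _ ?N _ ?N])
  qed
  have conj_col: "conj C $$ (i, 0) = 0" if C: "C \<in> Cs" and i: "0 < i" "i < ?N" for C i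
  proof -
    obtain x where x: "C *\<^sub>v v = x \<cdot>\<^sub>v v" using v(3) C by blast
    have vc: "v \<in> carrier_vec ?N" using v by (simp add: vecs_over_def)
    \<comment> \<open>As \<open>v\<close> is column 0 of \<open>T1\<close>, it is sent by
      \<open>S1\<close> to the first unit vector, and column 0 of \<open>conj C\<close> is a
      multiple of that vector.\<close>
    have "S1 *\<^sub>v v = col (S1 * T1) 0" using c1 col by auto
    then have Sv: "S1 *\<^sub>v v = unit_vec ?N 0" using TS by simp
    have "col (conj C) 0 = (S1 * C) *\<^sub>v v" unfolding conj_def
      using c1 carr[OF C] unfolding col[symmetric] by (intro col_mult2) auto
    also have "\<dots> = x \<cdot>\<^sub>v unit_vec ?N 0"
      using c1 carr[OF C] vc x Sv by (simp add: mult_mat_vec)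
    finally have "col (conj C) 0 $ i = 0" using i by simp
    then show ?thesis using conj_carr[OF C] i by simp
  qed
  define top where "top C = mat 1 n (\<lambda>(i, j). conj C $$ (0, Suc j))" for C
  define corner where "corner C = mat 1 1 (\<lambda>_. conj C $$ (0, 0))" for C
  define sub where "sub C = mat n n (\<lambda>(i, j). conj C $$ (Suc i, Suc j))" for C
  have sub_carr: "top C \<in> carrier_mat 1 n" "corner C \<in> carrier_mat 1 1"
      "sub C \<in> carrier_mat n n" for C
    by (auto simp: top_def corner_def sub_def)
  have block: "conj C = four_block_mat (corner C) (top C) (0\<^sub>m n 1) (sub C)" if "C \<in> Cs" for C
    using conj_carr[OF that] conj_col[OF that]
    by (intro eq_matI) (auto simp: top_def corner_def sub_def)
  have sub_over: "sub ` Cs \<subseteq> mats_over K n"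
    using conj_over by (auto simp: mats_over_iff sub_def)
  \<comment> \<open>The lower left blocks vanish, so taking the lower right block respects products
    and commutation passes to the blocks.\<close>
  have sub_mult: "sub A * sub B = mat n n (\<lambda>(i, j). (conj A * conj B) $$ (Suc i, Suc j))"
    if "A \<in> Cs" "B \<in> Cs" for A B
  proof -
    have "conj A * conj B = four_block_mat (corner A * corner B + top A * 0\<^sub>m n 1)
        (corner A * top B + top A * sub B) (0\<^sub>m n 1 * corner B + sub A * 0\<^sub>m n 1)
        (0\<^sub>m n 1 * top B + sub A * sub B)"
      unfolding block[OF that(1)] block[OF that(2)]
      by (rule mult_four_block_mat[of _ 1 1 _ n _ n _ _ 1 _ n]) (use sub_carr in auto)
    then show ?thesis
      using sub_carr[of A] sub_carr[of B]
      by (intro eq_matI) auto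
  qed
  have "X * Y = Y * X" if "X \<in> sub ` Cs" "Y \<in> sub ` Cs" for X Y
    using that Suc.prems(3) by (auto simp: sub_mult conj_mult)
  from Suc.IH[OF _ sub_over this] Suc.prems(1) obtain T2 S2
    where T2: "T2 \<in> mats_over K n" and S2: "S2 \<in> mats_over K n"
      and TS2: "T2 * S2 = 1\<^sub>m n" "S2 * T2 = 1\<^sub>m n"
      and ut: "\<forall>C\<in>Cs. upper_triangular (S2 * sub C * T2)"
    by auto
  have c2: "T2 \<in> carrier_mat n n" "S2 \<in> carrier_mat n n"
    using T2 S2 by (auto simp: mats_over_def)
  \<comment> \<open>Bordering by a 1 makes the second change of basis keep the eigenvector
    \<open>v\<close> as the first column.\<close>
  define ext where "ext A = four_block_mat (1\<^sub>m 1) (0\<^sub>m 1 n) (0\<^sub>m n 1) A" for A :: "'a mat"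
  have ext_over: "ext A \<in> mats_over K ?N" if "A \<in> mats_over K n" for A
    using that by (auto simp: ext_def mats_over_iff subfield_closed)
  have ext_mult: "ext A * ext B = ext (A * B)"
    if "A \<in> carrier_mat n n" "B \<in> carrier_mat n n" for A B
    unfolding ext_def using that by (subst mult_four_block_mat[of _ 1 1 _ n _ n _ _ 1 _ n]) auto
  have ext_one: "ext (1\<^sub>m n) = 1\<^sub>m ?N"
    by (auto simp: ext_def)
  have e: "ext T2 \<in> carrier_mat ?N ?N" "ext S2 \<in> carrier_mat ?N ?N"
    using ext_over S2 T2 by (auto simp: mats_over_def)
  define T where "T = T1 * ext T2"
  define S where "S = ext S2 * S1"
  have "T \<in> mats_over K ?N" "S \<in> mats_over K ?N"
    unfolding T_def S_def using T1 S1 ext_over T2 S2 by (auto intro!: mult_mat_over)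
  moreover have "T * S = 1\<^sub>m ?N"
  proof -
    have "T * S = T1 * (ext T2 * ext S2) * S1"
      unfolding T_def S_def using c1 e by (simp add: assoc_mult_mat[of _ ?N ?N _ ?N _ ?N])
    then show ?thesis using c1 TS by (simp add: ext_mult[OF c2] TS2 ext_one)
  qed
  moreover have "S * T = 1\<^sub>m ?N"
  proof -
    have "S * T = ext S2 * (S1 * T1) * ext T2"
      unfolding T_def S_def using c1 e by (simp add: assoc_mult_mat[of _ ?N ?N _ ?N _ ?N])
    then show ?thesis using e TS by (simp add: ext_mult[OF c2(2,1)] TS2 ext_one)
  qed
  moreover have "upper_triangular (S * C * T)" if C: "C \<in> Cs" for C
  proof -
    have "S * C * T = ext S2 * conj C * ext T2"
      unfolding T_def S_def conj_def
      using c1 e carr[OF C] by (simp add: assoc_mult_mat[of _ ?N ?N _ ?N _ ?N])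
    \<comment> \<open>Both outer factors are block diagonal, so the zero block persists and the
      lower right block becomes the one triangularized by \<open>T2\<close>.\<close>
    also have "\<dots> = four_block_mat (corner C) (top C) (0\<^sub>m n 1) (S2 * sub C) * ext T2"
      unfolding block[OF C] ext_def using c2 sub_carr[of C]
      by (subst mult_four_block_mat[of _ 1 1 _ n _ n _ _ 1 _ n]) auto
    also have "\<dots> = four_block_mat (corner C) (top C * T2) (0\<^sub>m n 1) (S2 * sub C * T2)"
      unfolding ext_def using c2 sub_carr[of C]
      by (subst mult_four_block_mat[of _ 1 1 _ n _ n _ _ 1 _ n]) auto
    also have "upper_triangular \<dots>"
    proof (rule upper_triangular_four_block)
      show "upper_triangular (corner C)" by (auto simp: corner_def)
      show "upper_triangular (S2 * sub C * T2)" using ut C by blast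
    qed (use c2 sub_carr[of C] in auto)
    finally show ?thesis .
  qed
  ultimately show ?case by blast
qed

end

section \<open>Linear combinations over the differential field\<close>

text \<open>The double sum displays the entry as linear in the entries of \<open>M\<close>, so that
  a linear combination can be pulled out of the conjugation.\<close>

lemma index_triple_mult_mat:
  assumes "S \<in> carrier_mat n n" "M \<in> carrier_mat n n" "T \<in> carrier_mat n n" "a < n" "b < n"
  shows "(S * M * T) $$ (a, b) = (\<Sum>c<n. \<Sum>d<n. S $$ (a, c) * M $$ (c, d) * T $$ (d, b))"
  using assms by (simp add: scalar_prod_def lessThan_atLeast0 sum_distrib_left mult.assoc)

theorem theorem13:
  fixes D :: "'a::field \<Rightarrow> 'a" and n :: nat and M :: "'a mat"
  assumes "differential_field D"
    and "alg_closed_subfield (constants D)"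
    and "M \<in> carrier_mat n n"
    and "type_1 D n M"
  shows "triangularizable (constants D) n M"
proof -
  let ?K = "constants D"
  have K: "is_subfield ?K" using assms(2) by (simp add: alg_closed_subfield_def)
  obtain k :: nat and f C where C: "\<forall>j\<in>{1..k}. C j \<in> mats_over ?K n"
    and comm: "\<forall>i\<in>{1..k}. \<forall>j\<in>{1..k}. C i * C j = C j * C i"
    and M: "M = mat n n (\<lambda>(a, b). \<Sum>j = 1..k. (f j \<cdot>\<^sub>m C j) $$ (a, b))"
    using assms(4) unfolding type_1_def by blast
  \<comment> \<open>The constant matrices are triangularized before the coefficients
    \<open>f j\<close> enter; \<open>k = 0\<close> is included, with an empty family.\<close>
  obtain T S where T: "T \<in> mats_over ?K n" and S: "S \<in> mats_over ?K n"
    and TS: "T * S = 1\<^sub>m n" "S * T = 1\<^sub>m n"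
    and ut: "\<forall>A\<in>C ` {1..k}. upper_triangular (S * A * T)"
    using simultaneous_triangularization[OF K assms(2), of "C ` {1..k}" n] C comm by blast
  have carr: "T \<in> carrier_mat n n" "S \<in> carrier_mat n n"
    using T S by (auto simp: mats_over_def)
  have Cc: "C j \<in> carrier_mat n n" if "j \<in> {1..k}" for j
    using C that by (auto simp: mats_over_def)
  have M_index: "M $$ (c, d) = (\<Sum>j = 1..k. f j * C j $$ (c, d))" if "c < n" "d < n" for c d
    using that carrier_matD[OF Cc] by (auto simp: M intro!: sum.cong)
  have "upper_triangular (S * M * T)"
  proof (rule upper_triangularI)
    fix a b assume "b < a" "a < dim_row (S * M * T)"
    then have ab: "a < n" "b < n" "b < a" using carr by auto
    have "(S * M * T) $$ (a, b)
        = (\<Sum>c<n. \<Sum>d<n. \<Sum>j = 1..k. f j * (S $$ (a, c) * C j $$ (c, d) * T $$ (d, b)))"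
      unfolding index_triple_mult_mat[OF carr(2) assms(3) carr(1) ab(1,2)]
      by (intro sum.cong) (simp_all add: M_index sum_distrib_left sum_distrib_right mult_ac)
    also have "\<dots> = (\<Sum>j = 1..k. \<Sum>c<n. \<Sum>d<n. f j * (S $$ (a, c) * C j $$ (c, d) * T $$ (d, b)))"
      by (subst sum.swap[of _ "{1..k}"], subst sum.swap) (rule refl)
    \<comment> \<open>Each inner double sum is \<open>f j\<close> times an entry of the conjugate of
      \<open>C j\<close>, which vanishes below the diagonal.\<close>
    also have "\<dots> = (\<Sum>j = 1..k. f j * (S * C j * T) $$ (a, b))"
      using Cc by (intro sum.cong)
        (simp_all only: index_triple_mult_mat[OF carr(2) Cc carr(1) ab(1,2)] sum_distrib_left)
    also have "\<dots> = 0"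
    proof (intro sum.neutral ballI)
      fix j assume "j \<in> {1..k}"
      then have "upper_triangular (S * C j * T)" using ut by blast
      then have "(S * C j * T) $$ (a, b) = 0"
        by (rule upper_triangularD) (use ab carr in auto)
      then show "f j * (S * C j * T) $$ (a, b) = 0" by simp
    qed
    finally show "(S * M * T) $$ (a, b) = 0" .
  qed
  then show ?thesis
    using T carr TS unfolding triangularizable_def inverts_mat_def by auto
qed

end
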